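(* Let $\mathbb{F}\subset\mathbb{K}$ be fields of characteristic zero, let $n$ be a positive integer, let $\kappa\in\mathbb{K}$, and let $f\colon\mathbb{F}\to\mathbb{K}$ be a generalized monomial of degree $n$ such that \[ f(x^{2})=\kappa\cdot x^{n}f(x)\qquad (x\in\mathbb{F}). \] Then: (i) if $\kappa\notin\{2^{k}\mid k=0,1,\ldots,n\}$, then $f$ is identically zero; (ii) if $\kappa=1$, then $f(x)=f(1)\cdot x^{n}$ for all $x\in\mathbb{F}$; (iii) if $\kappa=2$, then there exist a derivation $a\colon\mathbb{F}\to\mathbb{K}$ of order $2n-1$ and constants $\lambda_{n,1},\ldots,\lambda_{n,n}\in\mathbb{K}$ such that \[ f(x)=\sum_{j=1}^{n}\lambda_{n,j}\,x^{n-j}a(x^{j})\qquad (x\in\mathbb{F}); \] (iv) if $\kappa=2^{n}$, then there exists a symmetric $n$-additive mapping $A_{n}\colon\mathbb{F}^{n}\to\mathbb{K}$ with $f(x)=A_{n}(x,\ldots,x)$ for all $x\in\mathbb{F}$ and \[ \sum_{\sigma\in\mathscr{S}_{n+1}}\Big\{A_{n}(x_{\sigma(1)}x_{\sigma(2)},x_{\sigma(3)},\ldots,x_{\sigma(n+1)})-x_{\sigma(1)}A_{n}(x_{\sigma(2)},x_{\sigma(3)},\ldots,x_{\sigma(n+1)})-x_{\sigma(2)}A_{n}(x_{\sigma(1)},x_{\sigma(3)},\ldots,x_{\sigma(n+1)})\Big\}=0 \] for all $x_{1},\ldots,x_{n+1}\in\mathbb{F}$, where $\mathscr{S}_{n+1}$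 is the symmetric group on $\{1,\ldots,n+1\}$.
   Context: A map $A\colon\mathbb{F}^{n}\to\mathbb{K}$ is $n$-additive if it is additive (a homomorphism of the additive groups) in each variable separately; it is symmetric if invariant under permutations of its arguments. A generalized monomial of degree $n$ is a function $f\colon\mathbb{F}\to\mathbb{K}$ of the form $f(x)=A(x,\ldots,x)$ for some symmetric $n$-additive $A\colon\mathbb{F}^{n}\to\mathbb{K}$ (such $A$ is uniquely determined by $f$). Derivations of higher order: the identically zero map is the only derivation of order $0$; for $m\ge1$, an additive map $d\colon\mathbb{F}\to\mathbb{K}$ is a derivation of order $m$ if there is a map $B\colon\mathbb{F}\times\mathbb{F}\to\mathbb{K}$ which is a derivation of order $m-1$ in each variable such that $d(xy)-xd(y)-d(x)y=B(x,y)$ for all $x,y\in\mathbb{F}$. *)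

theory Defs
  imports Main "HOL-Combinatorics.Permutations"
begin

text \<open>The field inclusion F \<subseteq> K is modelled by a field embedding
  \<iota> : F \<rightarrow> K (an injective unital ring homomorphism).\<close>
definition field_embedding :: "('a::field \<Rightarrow> 'b::field) \<Rightarrow> bool" where
  "field_embedding \<iota> \<longleftrightarrow> inj \<iota> \<and> \<iota> 1 = 1 \<and>
     (\<forall>x y. \<iota> (x + y) = \<iota> x + \<iota> y) \<and> (\<forall>x y. \<iota> (x * y) = \<iota> x * \<iota> y)"

definition additive_map :: "('a::ab_group_add \<Rightarrow> 'b::ab_group_add) \<Rightarrow> bool" where
  "additive_map d \<longleftrightarrow> (\<forall>x y. d (x + y) = d x + d y)"

text \<open>Maps F^n \<rightarrow> K are represented as functions on lists; only lists of
  length n are relevant.\<close>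
definition n_additive :: "nat \<Rightarrow> ('a::ab_group_add list \<Rightarrow> 'b::ab_group_add) \<Rightarrow> bool" where
  "n_additive n A \<longleftrightarrow> (\<forall>xs i x y. length xs = n \<and> i < n \<longrightarrow>
      A (xs[i := x + y]) = A (xs[i := x]) + A (xs[i := y]))"

definition symmetric_map :: "nat \<Rightarrow> ('a list \<Rightarrow> 'b) \<Rightarrow> bool" where
  "symmetric_map n A \<longleftrightarrow> (\<forall>xs \<sigma>. length xs = n \<and> \<sigma> permutes {..<n} \<longrightarrow>
      A (map (\<lambda>i. xs ! \<sigma> i) [0..<n]) = A xs)"

definition generalized_monomial :: "nat \<Rightarrow> ('a::ab_group_add \<Rightarrow> 'b::ab_group_add) \<Rightarrow> bool" where
  "generalized_monomial n f \<longleftrightarrow> (\<exists>A. n_additive n A \<and> symmetric_map n A \<and>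
      (\<forall>x. f x = A (replicate n x)))"

primrec higher_derivation :: "('a::field \<Rightarrow> 'b::field) \<Rightarrow> nat \<Rightarrow> ('a \<Rightarrow> 'b) \<Rightarrow> bool" where
  "higher_derivation \<iota> 0 d \<longleftrightarrow> d = (\<lambda>_. 0)"
| "higher_derivation \<iota> (Suc m) d \<longleftrightarrow> additive_map d \<and>
     (\<exists>B. (\<forall>y. higher_derivation \<iota> m (\<lambda>x. B x y)) \<and>
          (\<forall>x. higher_derivation \<iota> m (\<lambda>y. B x y)) \<and>
          (\<forall>x y. d (x * y) - \<iota> x * d y - d x * \<iota> y = B x y))"

end

theory Submission
  imports Defs "HOL-Computational_Algebra.Polynomial"
begin

text \<open>Write \<open>f (1 + z) = (\<Sum>k\<le>n. F k z)\<close> with \<open>F k\<close> a generalized monomial of degree \<open>k\<close>, and compare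
  the coefficients of \<open>t ^ k\<close> in the equation at \<open>x = 1 + t y\<close>. The lowest nonzero component
  satisfies \<open>2 ^ k * F k y = \<kappa> * F k y\<close>, which gives (i), and (ii) after subtracting \<open>f 1 * x ^ n\<close>. For
  \<open>\<kappa> = 2 ^ n\<close> only \<open>F n = f\<close> survives; the coefficient of \<open>t ^ (n + 1)\<close> is
  \<open>A (y\<^sup>2, y, \<dots>, y) = 2 y A (y, \<dots>, y)\<close>, whose polarization is (iv).

  For \<open>\<kappa> = 2\<close> put \<open>a = F 1\<close>. Inductively every \<open>F k\<close> is a combination of the
  \<open>y ^ (k - j) * a (y ^ j)\<close> with \<open>1 \<le> j \<le> k\<close>. Inserting the resulting formula for \<open>f\<close> into the equation
  gives a nontrivial relation \<open>(\<Sum>j=1..2n. \<mu> j * x ^ (2n - j) * a (x ^ j)) = 0\<close>, and such a relation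
  forces \<open>a\<close> to be a derivation of order \<open>2n - 1\<close>.\<close>

section \<open>Symmetric multiadditive maps\<close>

text \<open>Symmetry is stated through multisets, so reordering arguments is a multiset computation,
  and additivity in the head entry then gives additivity in every entry.\<close>

definition symmetric_additive :: "nat \<Rightarrow> ('a::ab_group_add list \<Rightarrow> 'b::ab_group_add) \<Rightarrow> bool" where
  "symmetric_additive n A \<longleftrightarrow>
     (\<forall>xs ys. length xs = n \<longrightarrow> mset xs = mset ys \<longrightarrow> A xs = A ys) \<and>
     (\<forall>x y zs. Suc (length zs) = n \<longrightarrow> A ((x + y) # zs) = A (x # zs) + A (y # zs))"

lemma symmetric_additiveI:
  assumes "\<And>xs ys. length xs = n \<Longrightarrow> mset xs = mset ys \<Longrightarrow> A xs = A ys"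
    and "\<And>x y zs. Suc (length zs) = n \<Longrightarrow> A ((x + y) # zs) = A (x # zs) + A (y # zs)"
  shows "symmetric_additive n A"
  using assms unfolding symmetric_additive_def by blast

lemma symmetric_additive_mset:
  "symmetric_additive n A \<Longrightarrow> length xs = n \<Longrightarrow> mset xs = mset ys \<Longrightarrow> A xs = A ys"
  unfolding symmetric_additive_def by blast

lemma symmetric_additive_add:
  "symmetric_additive n A \<Longrightarrow> Suc (length zs) = n \<Longrightarrow> A ((x + y) # zs) = A (x # zs) + A (y # zs)"
  unfolding symmetric_additive_def by blast

lemma symmetric_additive_of_n_additive:
  assumes "n_additive n A" "symmetric_map n A"
  shows "symmetric_additive n A"
proof (rule symmetric_additiveI)
  fix xs ys :: "'a list" assume "length xs = n" "mset xs = mset ys"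
  moreover from this obtain p where "p permutes {..<length ys}" "permute_list p ys = xs"
    by (metis mset_eq_permutation)
  ultimately show "A xs = A ys"
    using assms(2) unfolding symmetric_map_def permute_list_def by (metis mset_eq_length)
next
  fix x y :: 'a and zs :: "'a list" assume "Suc (length zs) = n"
  then have "A ((x # zs)[0 := x + y]) = A ((x # zs)[0 := x]) + A ((x # zs)[0 := y])"
    using assms(1) unfolding n_additive_def by (metis length_Cons zero_less_Suc)
  then show "A ((x + y) # zs) = A (x # zs) + A (y # zs)" by simp
qed

lemma symmetric_additive_append:
  assumes A: "symmetric_additive n A" and n: "length zs + k = n"
  shows "symmetric_additive k (\<lambda>xs. A (zs @ xs))"
proof (rule symmetric_additiveI)
  fix xs ys :: "'a list" assume "length xs = k" "mset xs = mset ys"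
  then show "A (zs @ xs) = A (zs @ ys)"
    using n by (intro symmetric_additive_mset[OF A]) auto
next
  fix x y and us :: "'a list" assume us: "Suc (length us) = k"
  have move: "A (zs @ w # us) = A (w # zs @ us)" for w
    using n us by (intro symmetric_additive_mset[OF A]) auto
  show "A (zs @ (x + y) # us) = A (zs @ x # us) + A (zs @ y # us)"
    unfolding move using n us by (intro symmetric_additive_add[OF A]) auto
qed

lemma symmetric_additive_Cons:
  "symmetric_additive (Suc n) A \<Longrightarrow> symmetric_additive n (\<lambda>xs. A (x # xs))"
  using symmetric_additive_append[of "Suc n" A "[x]" n] by simp

text \<open>In \<open>H m i k\<close>, \<open>m\<close> factors are still unresolved while
  \<open>i\<close> and \<open>k\<close> count those resolved in each of two ways; Pascal's rule does
  the bookkeeping. It serves both the diagonal of a multiadditive map at \<open>x + y\<close> and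
  the expansion of \<open>a (x ^ m)\<close>.\<close>

lemma pascal_expansion:
  fixes H :: "nat \<Rightarrow> nat \<Rightarrow> nat \<Rightarrow> 'b::comm_ring_1"
  assumes rec: "\<And>m i k. Suc m + i + k = N \<Longrightarrow> H (Suc m) i k = H m (Suc i) k + H m i (Suc k)"
  shows "m + i + k = N \<Longrightarrow> H m i k = (\<Sum>r\<le>m. of_nat (m choose r) * H 0 (i + (m - r)) (k + r))"
proof (induction m arbitrary: i k)
  case 0
  then show ?case by simp
next
  case (Suc m)
  let ?h = "\<lambda>r. H 0 (i + (Suc m - r)) (k + r)"
  have 1: "H m (Suc i) k = (\<Sum>r\<le>Suc m. of_nat (m choose r) * ?h r)"
    using Suc.prems by (subst Suc.IH) (auto simp: Suc_diff_le binomial_eq_0 intro!: sum.cong)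
  have 2: "H m i (Suc k) = (\<Sum>r\<le>m. of_nat (m choose r) * ?h (Suc r))"
    using Suc.prems by (subst Suc.IH) (auto intro!: sum.cong)
  have "H (Suc m) i k = ?h 0 + (\<Sum>r\<le>m. of_nat (m choose Suc r) * ?h (Suc r))
      + (\<Sum>r\<le>m. of_nat (m choose r) * ?h (Suc r))"
    unfolding rec[OF Suc.prems] 1 2 by (subst sum.atMost_Suc_shift) simp
  also have "\<dots> = (\<Sum>r\<le>Suc m. of_nat (Suc m choose r) * ?h r)"
    by (simp add: sum.atMost_Suc_shift sum.distrib algebra_simps del: sum.atMost_Suc)
  finally show ?case .
qed

lemma symmetric_additive_binomial:
  fixes A :: "'a::ab_group_add list \<Rightarrow> 'b::comm_ring_1"
  assumes A: "symmetric_additive n A"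
  shows "A (replicate n (x + y)) =
    (\<Sum>r\<le>n. of_nat (n choose r) * A (replicate (n - r) x @ replicate r y))"
proof -
  define H where "H = (\<lambda>m i k. A (replicate m (x + y) @ replicate i x @ replicate k y))"
  have "H (Suc m) i k = H m (Suc i) k + H m i (Suc k)" if "Suc m + i + k = n" for m i k
  proof -
    let ?zs = "replicate m (x + y) @ replicate i x @ replicate k y"
    have "H (Suc m) i k = A ((x + y) # ?zs)" by (simp add: H_def)
    also have "\<dots> = A (x # ?zs) + A (y # ?zs)"
      using that by (intro symmetric_additive_add[OF A]) auto
    also have "A (x # ?zs) = H m (Suc i) k"
      unfolding H_def using that by (intro symmetric_additive_mset[OF A]) auto
    also have "A (y # ?zs) = H m i (Suc k)"
      unfolding H_def using that by (intro symmetric_additive_mset[OF A]) auto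
    finally show ?thesis .
  qed
  from pascal_expansion[of n H, OF this, of n 0 0] show ?thesis by (simp add: H_def)
qed

section \<open>Homogeneity under natural scalars\<close>

lemma symmetric_additive_scale_Cons:
  fixes A :: "'a::ring_1 list \<Rightarrow> 'b::ring_1"
  assumes A: "symmetric_additive n A" and n: "Suc (length zs) = n"
  shows "A ((of_nat t * x) # zs) = of_nat t * A (x # zs)"
proof (induction t)
  case 0
  have "A ((0 + 0) # zs) = A (0 # zs) + A (0 # zs)"
    using symmetric_additive_add[OF A n, of 0 0] .
  then show ?case by simp
next
  case (Suc t)
  then show ?case
    using symmetric_additive_add[OF A n, of x "of_nat t * x"] by (simp add: distrib_right)
qed

lemma symmetric_additive_scale:
  fixes A :: "'a::ring_1 list \<Rightarrow> 'b::comm_ring_1"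
  assumes A: "symmetric_additive n A"
  shows "length zs + k = n \<Longrightarrow>
    A (zs @ replicate k (of_nat t * x)) = of_nat t ^ k * A (zs @ replicate k x)"
proof (induction k arbitrary: zs)
  case 0
  then show ?case by simp
next
  case (Suc k)
  let ?c = "of_nat t * x"
  have "A (zs @ replicate (Suc k) ?c) = A (?c # zs @ replicate k ?c)"
    using Suc.prems by (intro symmetric_additive_mset[OF A]) auto
  also have "\<dots> = of_nat t * A ((x # zs) @ replicate k ?c)"
    using Suc.prems by (subst symmetric_additive_scale_Cons[OF A]) auto
  also have "\<dots> = of_nat t * (of_nat t ^ k * A ((x # zs) @ replicate k x))"
    using Suc.prems by (subst Suc.IH) auto
  also have "A ((x # zs) @ replicate k x) = A (zs @ replicate (Suc k) x)"
    using Suc.prems by (intro symmetric_additive_mset[OF A]) auto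
  finally show ?case by (simp add: mult.assoc)
qed

text \<open>In characteristic zero the natural numbers are infinitely many roots of
  \<open>p - q\<close>. Additivity yields homogeneity under natural scalars, so identities at
  natural \<open>t\<close> become identities of coefficients.\<close>

lemma poly_eq_of_nat_points:
  fixes p q :: "'b::field_char_0 poly"
  assumes "\<And>t::nat. poly p (of_nat t) = poly q (of_nat t)"
  shows "p = q"
proof (rule ccontr)
  assume "p \<noteq> q"
  then have "finite {x. poly (p - q) x = 0}" by (intro poly_roots_finite) simp
  moreover have "range of_nat \<subseteq> {x. poly (p - q) x = 0}" using assms by auto
  ultimately have "finite (range (of_nat :: nat \<Rightarrow> 'b))" by (rule rev_finite_subset)
  then show False by (simp add: finite_image_iff inj_of_nat)
qed

text \<open>This is the diagonal of \<open>A\<close> along the line \<open>u + t v\<close>, as a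
  polynomial in \<open>t\<close> over the target field.\<close>

definition line_poly ::
    "nat \<Rightarrow> ('a::ring_1 list \<Rightarrow> 'b::comm_ring_1) \<Rightarrow> 'a \<Rightarrow> 'a \<Rightarrow> 'b poly" where
  "line_poly n A u v =
     (\<Sum>r\<le>n. monom (of_nat (n choose r) * A (replicate (n - r) u @ replicate r v)) r)"

lemma poly_line_poly:
  assumes A: "symmetric_additive n A"
  shows "poly (line_poly n A u v) (of_nat t) = A (replicate n (u + of_nat t * v))"
  unfolding line_poly_def symmetric_additive_binomial[OF A] poly_sum poly_monom
  by (intro sum.cong) (auto simp: symmetric_additive_scale[OF A])

lemma coeff_line_poly:
  "coeff (line_poly n A u v) r =
    (if r \<le> n then of_nat (n choose r) * A (replicate (n - r) u @ replicate r v) else 0)"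
  by (auto simp: line_poly_def coeff_sum)

text \<open>If the diagonal vanishes, so does \<open>line_poly\<close> along \<open>x + t y\<close>.
  Its linear coefficient is a nonzero multiple of \<open>A\<close> at one \<open>y\<close> and
  otherwise \<open>x\<close>, so fixing \<open>y\<close> leaves a map in one variable fewer with
  zero diagonal.\<close>

lemma polarization_zero:
  fixes A :: "'a::ring_1 list \<Rightarrow> 'b::field_char_0"
  assumes "symmetric_additive n A" and "\<And>x. A (replicate n x) = 0" and "length xs = n"
  shows "A xs = 0"
  using assms
proof (induction n arbitrary: A xs)
  case 0
  then show ?case by (metis length_0_conv replicate_0)
next
  case (Suc n)
  obtain y ys where xs: "xs = y # ys" "length ys = n" using Suc.prems(3) by (cases xs) auto
  have diag: "A (y # replicate n x) = 0" for x
  proof -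
    have "line_poly (Suc n) A x y = 0"
      by (rule poly_eq_of_nat_points) (simp add: poly_line_poly[OF Suc.prems(1)] Suc.prems(2) del: replicate_Suc)
    then have "of_nat (Suc n) * A (replicate n x @ [y]) = 0"
      using coeff_line_poly[of "Suc n" A x y 1] by simp
    then have "A (replicate n x @ [y]) = 0" by (metis mult_eq_0_iff of_nat_neq_0)
    moreover have "A (replicate n x @ [y]) = A (y # replicate n x)"
      by (intro symmetric_additive_mset[OF Suc.prems(1)]) auto
    ultimately show ?thesis by simp
  qed
  show ?case
    unfolding xs using Suc.IH[OF symmetric_additive_Cons[OF Suc.prems(1)] diag xs(2)] .
qed

section \<open>Higher order derivations\<close>

locale embedding =
  fixes \<iota> :: "'a::field_char_0 \<Rightarrow> 'b::field_char_0"
  assumes emb: "field_embedding \<iota>"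
begin

lemma emb_simps [simp]:
  "\<iota> 1 = 1" "\<iota> (x + y) = \<iota> x + \<iota> y" "\<iota> (x * y) = \<iota> x * \<iota> y" "\<iota> 0 = 0" "\<iota> (of_nat t) = of_nat t"
    "\<iota> (numeral w) = numeral w" "\<iota> (x ^ k) = \<iota> x ^ k"
proof -
  show 1: "\<iota> 1 = 1" and add: "\<iota> (x + y) = \<iota> x + \<iota> y" and mult: "\<iota> (x * y) = \<iota> x * \<iota> y" for x y
    using emb by (auto simp: field_embedding_def)
  show 0: "\<iota> 0 = 0" using add[of 0 0] by simp
  show nat: "\<iota> (of_nat t) = of_nat t" for t by (induction t) (auto simp: 0 1 add)
  show "\<iota> (numeral w) = numeral w" using nat[of "numeral w"] by simp
  show "\<iota> (x ^ k) = \<iota> x ^ k" by (induction k) (auto simp: 1 mult)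
qed

text \<open>The commutator of \<open>g\<close> with multiplication by \<open>x\<close>; it vanishes
  for every \<open>x\<close> exactly when \<open>g\<close> is linear over the smaller field.\<close>

definition delta :: "'a \<Rightarrow> ('a \<Rightarrow> 'b) \<Rightarrow> 'a \<Rightarrow> 'b" where
  "delta x g = (\<lambda>y. g (x * y) - \<iota> x * g y)"

lemma delta_commute: "delta x \<circ> delta y = delta y \<circ> delta x"
  by (simp add: delta_def fun_eq_iff algebra_simps)

lemma fold_delta_add:
  "fold delta xs (\<lambda>z. g z + h z) = (\<lambda>z. fold delta xs g z + fold delta xs h z)"
proof (induction xs arbitrary: g h)
  case (Cons x xs)
  have "delta x (\<lambda>z. g z + h z) = (\<lambda>z. delta x g z + delta x h z)"
    by (simp add: delta_def fun_eq_iff algebra_simps)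
  then show ?case by (simp add: Cons.IH)
qed simp

lemma additive_delta: "additive_map g \<Longrightarrow> additive_map (delta x g)"
  by (simp add: additive_map_def delta_def algebra_simps)

lemma additive_map_of_nat:
  fixes g :: "'a \<Rightarrow> 'b"
  assumes "additive_map g"
  shows "g (of_nat t * y) = of_nat t * g y"
proof (induction t)
  case 0
  from assms have "g (0 + 0) = g 0 + g 0" unfolding additive_map_def by blast
  then show ?case by simp
next
  case (Suc t)
  then show ?case using assms by (simp add: additive_map_def distrib_right)
qed

lemma additive_map_sum:
  fixes g :: "'a \<Rightarrow> 'b"
  assumes "additive_map g"
  shows "g (\<Sum>i\<in>S. h i) = (\<Sum>i\<in>S. g (h i))"
proof -
  have "g 0 = 0" using additive_map_of_nat[OF assms, of 0] by simp
  then show ?thesis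
    using assms by (induction S rule: infinite_finite_induct) (auto simp: additive_map_def)
qed

text \<open>The operators \<open>delta x\<close> commute, and \<open>delta x a\<close> is additive
  in \<open>x\<close>. Hence polarization passes from powers of a single \<open>delta x\<close> to
  mixed products.\<close>

lemma symmetric_additive_fold_delta:
  assumes "additive_map a"
  shows "symmetric_additive n (\<lambda>xs. fold delta xs a 1)"
proof (rule symmetric_additiveI)
  fix xs ys :: "'a list" assume "mset xs = mset ys"
  then show "fold delta xs a 1 = fold delta ys a 1"
    using fold_multiset_equiv[of xs delta ys] delta_commute by metis
next
  fix x y and zs :: "'a list"
  have "delta (x + y) a = (\<lambda>z. delta x a z + delta y a z)"
    using assms by (simp add: delta_def fun_eq_iff additive_map_def algebra_simps)
  then show "fold delta ((x + y) # zs) a 1 = fold delta (x # zs) a 1 + fold delta (y # zs) a 1"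
    by (simp add: fold_delta_add)
qed

section \<open>Derivations of higher order through iterated differences\<close>

lemma higher_derivation_Suc: "higher_derivation \<iota> m d \<Longrightarrow> higher_derivation \<iota> (Suc m) d"
proof (induction m arbitrary: d)
  case 0
  then have "d = (\<lambda>_. 0)" by simp
  then show ?case by (auto simp: additive_map_def intro!: exI[of _ "\<lambda>_ _. 0"])
next
  case (Suc m)
  from Suc.prems obtain B where B: "additive_map d"
    "\<forall>y. higher_derivation \<iota> m (\<lambda>x. B x y)" "\<forall>x. higher_derivation \<iota> m (\<lambda>y. B x y)"
    "\<forall>x y. d (x * y) - \<iota> x * d y - d x * \<iota> y = B x y"
    by auto
  show ?case
    unfolding higher_derivation.simps(2)[of _ "Suc m"]
    by (intro conjI exI[of _ B] allI Suc.IH B[rule_format])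
qed

lemma higher_derivation_mono:
  "higher_derivation \<iota> m d \<Longrightarrow> m \<le> k \<Longrightarrow> higher_derivation \<iota> k d"
  by (rule dec_induct[of m k]) (simp_all only: higher_derivation_Suc)

text \<open>The Leibniz defect \<open>B x y\<close> is \<open>delta y a x\<close> minus
  \<open>\<iota> x * a y\<close>. One further difference in \<open>x\<close> kills the second term,
  so the defect satisfies the hypothesis with one difference fewer.\<close>

lemma higher_derivation_of_fold_delta:
  assumes "additive_map a" "a 1 = 0" "\<And>xs. length xs = Suc m \<Longrightarrow> fold delta xs a 1 = 0"
  shows "higher_derivation \<iota> m a"
  using assms
proof (induction m arbitrary: a)
  case 0
  have "a x = 0" for x using 0(2) 0(3)[of "[x]"] by (simp add: delta_def)
  then show ?case by (simp add: fun_eq_iff)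
next
  case (Suc m)
  define B where "B x y = a (x * y) - \<iota> x * a y - a x * \<iota> y" for x y
  have hd: "higher_derivation \<iota> m (\<lambda>x. B x y)" for y
  proof (rule Suc.IH)
    show "additive_map (\<lambda>x. B x y)"
      using Suc.prems(1) by (simp add: additive_map_def B_def algebra_simps)
    show "B 1 y = 0" using Suc.prems(2) by (simp add: B_def)
  next
    fix xs :: "'a list" assume "length xs = Suc m"
    then obtain z zs where xs: "xs = z # zs" "length zs = m" by (cases xs) auto
    have "delta z (\<lambda>x. B x y) = delta z (delta y a)"
      by (simp add: delta_def B_def fun_eq_iff algebra_simps)
    then have "fold delta xs (\<lambda>x. B x y) = fold delta (y # xs) a" by (simp add: xs)
    then show "fold delta xs (\<lambda>x. B x y) 1 = 0" using Suc.prems(3)[of "y # xs"] xs by simp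
  qed
  have sym: "(\<lambda>y. B x y) = (\<lambda>y. B y x)" for x
    by (rule ext) (simp add: B_def algebra_simps)
  have hd': "higher_derivation \<iota> m (\<lambda>y. B x y)" for x
    unfolding sym[of x] by (rule hd)
  show ?case
    unfolding higher_derivation.simps(2)
    by (intro conjI exI[of _ B] allI Suc.prems(1) hd hd') (simp add: B_def)
qed

text \<open>Precomposing \<open>a\<close> with multiplication by \<open>x\<close> is the operator
  \<open>\<iota> x + delta x\<close>; its two summands commute, and its \<open>m\<close>-th power is
  evaluated at 1.\<close>

lemma additive_power_expansion:
  "a (x ^ m) = (\<Sum>r\<le>m. of_nat (m choose r) * (\<iota> x ^ (m - r) * (delta x ^^ r) a 1))"
proof -
  define H where "H m i k = \<iota> x ^ i * (delta x ^^ k) a (x ^ m)" for m i k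
  have "H (Suc m) i k = H m (Suc i) k + H m i (Suc k)" for m i k
    by (simp add: H_def delta_def algebra_simps)
  from pascal_expansion[of m H, OF this, of m 0 0] show ?thesis by (simp add: H_def)
qed

text \<open>An additive map commutes with multiplication by a natural number, so
  \<open>delta\<close> does not see a natural shift of its index.\<close>

lemma funpow_delta_shift:
  assumes "additive_map a"
  shows "(delta (x + of_nat t) ^^ k) a = (delta x ^^ k) a"
proof (induction k)
  case (Suc k)
  have "additive_map ((delta x ^^ k) a)"
    using assms by (induction k) (auto intro: additive_delta)
  then have "delta (x + of_nat t) ((delta x ^^ k) a) = delta x ((delta x ^^ k) a)"
    using additive_map_of_nat[of "(delta x ^^ k) a" t]
    by (simp add: delta_def fun_eq_iff distrib_right additive_map_def)
  then show ?case using Suc.IH by simp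
qed simp

text \<open>Expanding \<open>a (x ^ j)\<close> in the iterated differences of \<open>a\<close> turns the relation into
  \<open>(\<Sum>r\<le>N. \<nu> r * x ^ (N - r) * D r x) = 0\<close>. Since \<open>D r (x + t) = D r x\<close> for natural \<open>t\<close>,
  each \<open>\<nu> r * D r x\<close> vanishes, and \<open>\<nu> J = \<mu> J\<close> for the top index \<open>J\<close>.\<close>

lemma higher_derivation_of_relation:
  assumes a: "additive_map a" "a 1 = 0"
    and rel: "\<And>x. (\<Sum>j=1..N. \<mu> j * \<iota> x ^ (N - j) * a (x ^ j)) = 0"
    and J: "1 \<le> J" "J \<le> N" "\<mu> J \<noteq> 0" and top: "\<And>j. J < j \<Longrightarrow> j \<le> N \<Longrightarrow> \<mu> j = 0"
  shows "higher_derivation \<iota> (N - 1) a"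
proof -
  define D where "D r x = (delta x ^^ r) a 1" for r x
  define \<nu> where "\<nu> r = (\<Sum>j=1..N. \<mu> j * of_nat (j choose r))" for r
  have expand: "(\<Sum>r\<le>N. \<nu> r * D r x * \<iota> x ^ (N - r)) = 0" for x
  proof -
    have "\<mu> j * \<iota> x ^ (N - j) * a (x ^ j) =
        (\<Sum>r\<le>N. \<mu> j * of_nat (j choose r) * D r x * \<iota> x ^ (N - r))" if "j \<le> N" for j
    proof -
      have "\<mu> j * \<iota> x ^ (N - j) * a (x ^ j) = (\<Sum>r\<le>j. \<mu> j * of_nat (j choose r) * D r x *
          (\<iota> x ^ (N - j) * \<iota> x ^ (j - r)))"
        by (simp add: additive_power_expansion[of a] D_def sum_distrib_left mult_ac)
      also have "\<dots> = (\<Sum>r\<le>j. \<mu> j * of_nat (j choose r) * D r x * \<iota> x ^ (N - r))"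
        using that by (simp flip: power_add)
      also have "\<dots> = (\<Sum>r\<le>N. \<mu> j * of_nat (j choose r) * D r x * \<iota> x ^ (N - r))"
        using that by (intro sum.mono_neutral_left) (auto simp: binomial_eq_0)
      finally show ?thesis .
    qed
    then have "0 = (\<Sum>j=1..N. \<Sum>r\<le>N. \<mu> j * of_nat (j choose r) * D r x * \<iota> x ^ (N - r))"
      using rel[of x] by simp
    also have "\<dots> = (\<Sum>r\<le>N. \<nu> r * D r x * \<iota> x ^ (N - r))"
      by (subst sum.swap) (simp add: \<nu>_def sum_distrib_right)
    finally show ?thesis by simp
  qed
  have "D J x = 0" for x
  proof -
    define p where "p = (\<Sum>r\<le>N. monom (\<nu> r * D r x) (N - r))"
    have "pcompose p [:\<iota> x, 1:] = 0"
    proof (rule poly_eq_of_nat_points)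
      fix t :: nat
      show "poly (pcompose p [:\<iota> x, 1:]) (of_nat t) = poly 0 (of_nat t)"
        using expand[of "x + of_nat t"]
        by (simp add: p_def poly_pcompose poly_sum poly_monom D_def funpow_delta_shift[OF a(1)])
    qed
    then have "p = 0" by (rule pcompose_eq_0) simp
    moreover have "coeff p (N - J) = (\<Sum>r\<le>N. if r = J then \<nu> r * D r x else 0)"
      unfolding p_def coeff_sum using J by (intro sum.cong) auto
    ultimately have "\<nu> J * D J x = 0" using J by simp
    moreover have "\<nu> J = (\<Sum>j=1..N. if j = J then \<mu> j else 0)"
      unfolding \<nu>_def using top by (intro sum.cong) (auto simp: not_less_iff_gr_or_eq binomial_eq_0)
    ultimately show ?thesis using J by simp
  qed
  \<comment> \<open>\<open>D J\<close> is only the diagonal of \<open>J\<close> differences;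
    polarization gives all mixed ones. This yields order \<open>J - 1\<close>, which is then padded
    to \<open>N - 1\<close>.\<close>
  then have "fold delta xs a 1 = 0" if "length xs = J" for xs
    using polarization_zero[OF symmetric_additive_fold_delta[OF a(1)] _ that] by (simp add: D_def)
  then have "higher_derivation \<iota> (J - 1) a"
    using J by (intro higher_derivation_of_fold_delta a) auto
  then show ?thesis using J by (rule_tac higher_derivation_mono) auto
qed

end

section \<open>Coefficient comparison\<close>

text \<open>The functional equation at \<open>1 + t y\<close>, with \<open>t\<close> a natural number, reads
  \<open>(\<Sum>j\<le>n. t ^ j * F j (2 y + t y\<^sup>2)) = \<kappa> (1 + t y) ^ n * (\<Sum>j\<le>n. t ^ j * F j y)\<close>
  for the homogeneous components \<open>F j\<close> of \<open>f\<close> at \<open>1\<close>.\<close>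

locale square_equation = embedding \<iota>
  for \<iota> :: "'a::field_char_0 \<Rightarrow> 'b::field_char_0" +
  fixes n :: nat and \<kappa> :: 'b and A :: "'a list \<Rightarrow> 'b"
  assumes sym_A: "symmetric_additive n A"
    and eq: "A (replicate n (x ^ 2)) = \<kappa> * \<iota> x ^ n * A (replicate n x)"
begin

definition F :: "nat \<Rightarrow> 'a \<Rightarrow> 'b" where
  "F k y = of_nat (n choose k) * A (replicate (n - k) 1 @ replicate k y)"

lemma F_top: "F n y = A (replicate n y)"
  by (simp add: F_def)

lemma F_scale: "k \<le> n \<Longrightarrow> F k (of_nat t * y) = of_nat t ^ k * F k y"
  by (simp add: F_def symmetric_additive_scale[OF sym_A])

lemma F_sum: "A (replicate n (1 + z)) = (\<Sum>k\<le>n. F k z)"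
  by (simp add: F_def symmetric_additive_binomial[OF sym_A])

text \<open>\<open>F k\<close> along the line \<open>2 y + t y ^ 2\<close>, which arises from
  \<open>(1 + t y) ^ 2 = 1 + t (2 y + t y ^ 2)\<close>.\<close>

definition component_poly :: "nat \<Rightarrow> 'a \<Rightarrow> 'b poly" where
  "component_poly k y =
     smult (of_nat (n choose k)) (line_poly k (\<lambda>xs. A (replicate (n - k) 1 @ xs)) (2 * y) (y ^ 2))"

lemma poly_component_poly:
  assumes "k \<le> n"
  shows "poly (component_poly k y) (of_nat t) = F k (2 * y + of_nat t * y ^ 2)"
proof -
  have "symmetric_additive k (\<lambda>xs. A (replicate (n - k) 1 @ xs))"
    using assms by (intro symmetric_additive_append[OF sym_A]) simp
  then show ?thesis by (simp add: component_poly_def F_def poly_line_poly)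
qed

lemma component_polyI:
  assumes "k \<le> n" and "\<And>t::nat. poly p (of_nat t) = F k (2 * y + of_nat t * y ^ 2)"
  shows "component_poly k y = p"
  by (rule poly_eq_of_nat_points) (simp add: assms poly_component_poly)

lemma coeff_component_poly_0: "k \<le> n \<Longrightarrow> coeff (component_poly k y) 0 = 2 ^ k * F k y"
  using poly_component_poly[of k y 0] F_scale[of k 2 y] by (simp add: poly_0_coeff_0)

lemma component_poly_identity:
  "(\<Sum>j\<le>n. monom 1 j * component_poly j y) =
     smult \<kappa> ([:1, \<iota> y:] ^ n * (\<Sum>j\<le>n. monom (F j y) j))"
proof (rule poly_eq_of_nat_points)
  fix t :: nat
  let ?t = "of_nat t :: 'a" and ?s = "of_nat t :: 'b"
  have "poly (\<Sum>j\<le>n. monom 1 j * component_poly j y) ?s = (\<Sum>j\<le>n. ?s ^ j * F j (2 * y + ?t * y ^ 2))"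
    by (simp add: poly_sum poly_monom poly_component_poly)
  also have "\<dots> = (\<Sum>j\<le>n. F j (?t * (2 * y + ?t * y ^ 2)))"
    by (simp add: F_scale)
  also have "\<dots> = A (replicate n (1 + ?t * (2 * y + ?t * y ^ 2)))"
    by (simp add: F_sum)
  also have "1 + ?t * (2 * y + ?t * y ^ 2) = (1 + ?t * y) ^ 2"
    by (simp add: power2_eq_square algebra_simps)
  also have "A (replicate n ((1 + ?t * y) ^ 2)) = \<kappa> * (1 + ?s * \<iota> y) ^ n * (\<Sum>j\<le>n. F j (?t * y))"
    by (simp add: eq F_sum)
  also have "\<dots> = poly (smult \<kappa> ([:1, \<iota> y:] ^ n * (\<Sum>j\<le>n. monom (F j y) j))) ?s"
    by (simp add: F_scale poly_sum poly_monom mult.assoc mult.commute[of "F _ _"])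
  finally show "poly (\<Sum>j\<le>n. monom 1 j * component_poly j y) ?s = \<dots>" .
qed

text \<open>Both sides are the coefficient of \<open>t ^ k\<close> in
  \<open>component_poly_identity\<close>. The bound \<open>min k n\<close> admits
  \<open>k = n + 1\<close>, the case that matters for \<kappa> = \<open>2 ^ n\<close>.\<close>

lemma coeff_identity:
  "(\<Sum>j\<le>min k n. coeff (component_poly j y) (k - j)) =
     \<kappa> * (\<Sum>j\<le>min k n. of_nat (n choose (k - j)) * \<iota> y ^ (k - j) * F j y)"
proof -
  have *: "(\<Sum>j\<le>n. if k < j then 0 else g j) = (\<Sum>j\<le>min k n. g j)" for g :: "nat \<Rightarrow> 'b"
    by (rule sum.mono_neutral_cong_right) auto
  have lin: "coeff ([:1, c:] ^ n) i = of_nat (n choose i) * c ^ i" for c :: 'b and i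
  proof (cases "i \<le> n")
    case True then show ?thesis by (simp add: coeff_linear_poly_power)
  next
    case False
    have "degree ([:1, c:] ^ n) \<le> degree [:1, c:] * n" by (rule degree_power_le)
    also have "\<dots> < i" using False by (auto split: if_splits)
    finally show ?thesis using False by (simp add: coeff_eq_0 binomial_eq_0)
  qed
  have "(\<Sum>j\<le>min k n. coeff (component_poly j y) (k - j)) =
      coeff (\<Sum>j\<le>n. monom 1 j * component_poly j y) k"
    by (simp add: coeff_sum coeff_monom_mult *)
  also have "\<dots> = \<kappa> * coeff (\<Sum>j\<le>n. monom (F j y) j * [:1, \<iota> y:] ^ n) k"
    unfolding component_poly_identity mult.commute[of "[:1, \<iota> y:] ^ n"]
    by (simp add: sum_distrib_right)
  also have "coeff (\<Sum>j\<le>n. monom (F j y) j * [:1, \<iota> y:] ^ n) k =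
      (\<Sum>j\<le>min k n. F j y * (of_nat (n choose (k - j)) * \<iota> y ^ (k - j)))"
    by (simp add: coeff_sum coeff_monom_mult * lin)
  finally show ?thesis by (simp add: mult_ac)
qed

section \<open>Vanishing components, and the eigenvalues 1 and \<open>2 ^ n\<close>\<close>

lemma lowest_component:
  assumes k: "k \<le> n" and low: "\<And>j z. j < k \<Longrightarrow> F j z = 0"
  shows "2 ^ k * F k y = \<kappa> * F k y"
proof -
  \<comment> \<open>With the lower components gone, only the index \<open>j = k\<close> contributes
    to the coefficient of \<open>t ^ k\<close> on either side.\<close>
  have "component_poly j y = 0" if "j < k" for j
    using k that by (intro component_polyI) (auto simp: low)
  then have "(\<Sum>j\<le>min k n. coeff (component_poly j y) (k - j)) = 2 ^ k * F k y"
    using k by (simp add: min_absorb1 lessThan_Suc_atMost[symmetric] coeff_component_poly_0)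
  moreover have "(\<Sum>j\<le>min k n. of_nat (n choose (k - j)) * \<iota> y ^ (k - j) * F j y) = F k y"
    using k by (simp add: min_absorb1 lessThan_Suc_atMost[symmetric] low)
  ultimately show ?thesis using coeff_identity[where k = k and y = y] by metis
qed

text \<open>Strong induction: a first nonzero component of degree \<open>k\<close> would force
  \<kappa> = \<open>2 ^ k\<close>. The disjunction lets degree 0 be handled separately for \<kappa>
  = 1, and \<open>m = n\<close> spares the top component for \<kappa> =
  \<open>2 ^ n\<close>.\<close>

lemma components_zero:
  assumes "m \<le> Suc n" and "\<And>k. k < m \<Longrightarrow> F k = (\<lambda>_. 0) \<or> \<kappa> \<noteq> 2 ^ k"
  shows "k < m \<Longrightarrow> F k y = 0"
proof (induction k arbitrary: y rule: less_induct)
  case (less k)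
  have "2 ^ k * F k y = \<kappa> * F k y"
    using less assms(1) by (intro lowest_component) auto
  with assms(2)[OF less.prems] show ?case by (auto simp: fun_eq_iff)
qed

lemma eigenvalue_one:
  assumes "\<kappa> = 1"
  shows "A (replicate n x) = A (replicate n 1) * \<iota> x ^ n"
proof -
  \<comment> \<open>\<open>f 1 * x ^ n\<close> itself solves the equation for \<kappa> = 1, and the
    product of the embedded arguments is its multiadditive form. The difference is a solution whose
    component of degree 0 is zero, while \<open>2 ^ k\<close> differs from 1 for positive
    \<open>k\<close>.\<close>
  define A' where "A' xs = A xs - A (replicate n 1) * prod_list (map \<iota> xs)" for xs
  have rep: "A' (replicate n x) = A (replicate n x) - A (replicate n 1) * \<iota> x ^ n" for x
    by (simp add: A'_def)
  have "symmetric_additive n A'"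
  proof (rule symmetric_additiveI)
    fix xs ys :: "'a list" assume *: "length xs = n" "mset xs = mset ys"
    then have "prod_mset (image_mset \<iota> (mset xs)) = prod_mset (image_mset \<iota> (mset ys))" by simp
    then have "prod_list (map \<iota> xs) = prod_list (map \<iota> ys)"
      by (metis mset_map prod_mset_prod_list)
    then show "A' xs = A' ys"
      using symmetric_additive_mset[OF sym_A *] by (simp add: A'_def)
  next
    fix x y and zs :: "'a list" assume "Suc (length zs) = n"
    then show "A' ((x + y) # zs) = A' (x # zs) + A' (y # zs)"
      by (simp add: A'_def symmetric_additive_add[OF sym_A] algebra_simps)
  qed
  then interpret A': square_equation \<iota> n \<kappa> A'
    by unfold_locales
      (auto simp: rep eq assms right_diff_distrib power2_eq_square[of "\<iota> _"] power_mult_distrib mult_ac)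
  have "A'.F 0 = (\<lambda>_. 0)"
    by (simp add: A'.F_def rep fun_eq_iff)
  moreover have "\<kappa> \<noteq> 2 ^ k" if "k > 0" for k
    using that assms of_nat_eq_iff[of "2 ^ k" 1, where 'a = 'b] by simp
  ultimately have "A'.F k = (\<lambda>_. 0) \<or> \<kappa> \<noteq> 2 ^ k" for k
    by (cases "k = 0") auto
  then have "A'.F n x = 0"
    by (intro A'.components_zero[of "Suc n"]) auto
  then show ?thesis by (simp add: A'.F_top rep)
qed

lemma eigenvalue_top:
  assumes \<kappa>: "\<kappa> = 2 ^ n" and n: "n = Suc m"
  shows "A (y ^ 2 # replicate m y) = 2 * \<iota> y * A (replicate n y)"
proof -
  have "(2::'b) ^ n \<noteq> 2 ^ k" if "k < n" for k
    using that of_nat_eq_iff[of "2 ^ n" "2 ^ k", where 'a = 'b] by simp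
  then have zero: "F k z = 0" if "k < n" for k z
    using that by (intro components_zero[of n]) (auto simp: \<kappa>)
  then have cp: "component_poly j y = 0" if "j < n" for j
    using that by (intro component_polyI) auto
  \<comment> \<open>Only \<open>j = n\<close> survives at \<open>k = n + 1\<close>. On the left the
    \<open>m\<close> arguments \<open>2 y\<close> will release \<open>2 ^ m\<close>, so one factor 2
    of \<kappa> remains after cancelling.\<close>
  have "coeff (component_poly n y) 1 = \<kappa> * (of_nat n * \<iota> y * F n y)"
    using coeff_identity[where k = "Suc n" and y = y]
    by (simp add: lessThan_Suc_atMost[symmetric] cp zero)
  moreover have "coeff (component_poly n y) 1 = of_nat n * A (replicate m (2 * y) @ [y ^ 2])"
    unfolding component_poly_def coeff_smult coeff_line_poly using n by simp
  moreover have "A (replicate m (2 * y) @ [y ^ 2]) = A ([y ^ 2] @ replicate m (of_nat 2 * y))"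
    using n by (intro symmetric_additive_mset[OF sym_A]) auto
  moreover have "\<dots> = 2 ^ m * A (y ^ 2 # replicate m y)"
    using n by (subst symmetric_additive_scale[OF sym_A]) auto
  moreover have "of_nat n \<noteq> (0::'b)" using n by (simp del: of_nat_Suc)
  ultimately have "2 ^ m * A (y ^ 2 # replicate m y) = \<kappa> * \<iota> y * F n y" 
    by (simp add: mult_ac)
  then have "2 ^ m * A (y ^ 2 # replicate m y) = 2 ^ m * (2 * \<iota> y * F n y)"
    by (simp add: \<kappa> n)
  then show ?thesis by (simp add: F_top)
qed

end

section \<open>The eigenvalue two\<close>

context embedding
begin

text \<open>The coefficients do not depend on \<open>y\<close>. The sum starts at
  \<open>i = 1\<close>, so degree 0 contains only the zero function, in agreement with
  \<open>F 0 = 0\<close> for \<kappa> = 2.\<close>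

definition power_span :: "('a \<Rightarrow> 'b) \<Rightarrow> nat \<Rightarrow> ('a \<Rightarrow> 'b) \<Rightarrow> bool" where
  "power_span a k g \<longleftrightarrow> (\<exists>c. \<forall>y. g y = (\<Sum>i=1..k. c i * \<iota> y ^ (k - i) * a (y ^ i)))"

lemma power_span_basis:
  assumes "1 \<le> i" "i \<le> k"
  shows "power_span a k (\<lambda>y. \<iota> y ^ (k - i) * a (y ^ i))"
  unfolding power_span_def
proof (intro exI allI)
  fix y
  have "(\<Sum>j=1..k. (if j = i then 1 else 0) * \<iota> y ^ (k - j) * a (y ^ j)) =
      (\<Sum>j=1..k. if j = i then \<iota> y ^ (k - j) * a (y ^ j) else 0)"
    by (intro sum.cong) auto
  then show "\<iota> y ^ (k - i) * a (y ^ i) =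
      (\<Sum>j=1..k. (if j = i then 1 else 0) * \<iota> y ^ (k - j) * a (y ^ j))"
    using assms by simp
qed

lemma power_span_scale: "power_span a k g \<Longrightarrow> power_span a k (\<lambda>y. u * g y)"
proof -
  assume "power_span a k g"
  then obtain c where "\<forall>y. g y = (\<Sum>i=1..k. c i * \<iota> y ^ (k - i) * a (y ^ i))"
    unfolding power_span_def by blast
  then show ?thesis
    unfolding power_span_def by (intro exI[of _ "\<lambda>i. u * c i"]) (simp add: sum_distrib_left mult.assoc)
qed

lemma power_span_add:
  assumes "power_span a k g" "power_span a k h"
  shows "power_span a k (\<lambda>y. g y + h y)"
proof -
  from assms obtain c d where "\<forall>y. g y = (\<Sum>i=1..k. c i * \<iota> y ^ (k - i) * a (y ^ i))"
    "\<forall>y. h y = (\<Sum>i=1..k. d i * \<iota> y ^ (k - i) * a (y ^ i))"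
    unfolding power_span_def by blast
  then show ?thesis
    unfolding power_span_def
    by (intro exI[of _ "\<lambda>i. c i + d i"]) (simp add: sum.distrib distrib_right)
qed

lemma power_span_zero: "power_span a k (\<lambda>_. 0)"
  unfolding power_span_def by (rule exI[of _ "\<lambda>_. 0"]) simp

lemma power_span_sum:
  "(\<And>s. s \<in> S \<Longrightarrow> power_span a k (g s)) \<Longrightarrow> power_span a k (\<lambda>y. \<Sum>s\<in>S. g s y)"
  by (induction S rule: infinite_finite_induct) (auto intro: power_span_zero power_span_add)

lemma power_span_mult:
  assumes "power_span a k g"
  shows "power_span a (k + r) (\<lambda>y. \<iota> y ^ r * g y)"
proof -
  obtain c where c: "\<And>y. g y = (\<Sum>i=1..k. c i * \<iota> y ^ (k - i) * a (y ^ i))"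
    using assms unfolding power_span_def by blast
  have "\<iota> y ^ r * g y = (\<Sum>i=1..k. c i * (\<iota> y ^ (k + r - i) * a (y ^ i)))" for y
    unfolding c sum_distrib_left
  proof (intro sum.cong refl)
    fix i assume "i \<in> {1..k}"
    then have "\<iota> y ^ (k + r - i) = \<iota> y ^ r * \<iota> y ^ (k - i)"
      by (simp add: add.commute flip: power_add)
    then show "\<iota> y ^ r * (c i * \<iota> y ^ (k - i) * a (y ^ i)) = c i * (\<iota> y ^ (k + r - i) * a (y ^ i))"
      by (simp add: mult_ac)
  qed
  moreover have "power_span a (k + r) (\<lambda>y. \<Sum>i=1..k. c i * (\<iota> y ^ (k + r - i) * a (y ^ i)))"
    by (intro power_span_sum power_span_scale power_span_basis) auto
  ultimately show ?thesis by simp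
qed

end

section \<open>Components for \<kappa> = 2 and the relation for \<open>a\<close>\<close>

context square_equation
begin

text \<open>Insert \<open>2 y + t y ^ 2\<close> into the formula for \<open>F j\<close>. The power
  of the embedded argument becomes a power of \<open>L y\<close>, and the value of \<open>a\<close>
  becomes \<open>Q i y\<close>. Their coefficients at \<open>s\<close> and \<open>l - s\<close> are
  multiples of \<open>\<iota> y ^ (j - i + s)\<close> and \<open>a (y ^ (i + (l - s)))\<close>, of
  total degree \<open>j + l\<close>.\<close>

lemma power_span_coeff_component_poly:
  assumes a: "additive_map a" and j: "j \<le> n" and span: "power_span a j (F j)"
  shows "power_span a (j + l) (\<lambda>y. coeff (component_poly j y) l)"
proof -
  obtain c where c: "\<And>y. F j y = (\<Sum>i=1..j. c i * \<iota> y ^ (j - i) * a (y ^ i))"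
    using span unfolding power_span_def by blast
  define Q where "Q i y = (\<Sum>r\<le>i. monom (of_nat ((i choose r) * 2 ^ (i - r)) * a (y ^ (i + r))) r)" for i y
  define L where "L y = [:2 * \<iota> y, \<iota> y ^ 2:]" for y
  have Q: "poly (Q i y) (of_nat t) = a ((2 * y + of_nat t * y ^ 2) ^ i)" for i y t
  proof -
    have "(2 * y + of_nat t * y ^ 2) ^ i = (of_nat t * y ^ 2 + 2 * y) ^ i" by (simp add: add.commute)
    also have "\<dots> = (\<Sum>r\<le>i. of_nat (i choose r) * (of_nat t * y ^ 2) ^ r * (2 * y) ^ (i - r))"
      by (rule binomial_ring)
    also have "\<dots> = (\<Sum>r\<le>i. of_nat ((i choose r) * 2 ^ (i - r) * t ^ r) * y ^ (i + r))"
    proof (intro sum.cong refl)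
      fix r assume "r \<in> {..i}"
      then have "(y ^ 2) ^ r * y ^ (i - r) = y ^ (i + r)"
        by (simp add: add.commute flip: power_mult power_add)
      then show "of_nat (i choose r) * (of_nat t * y ^ 2) ^ r * (2 * y) ^ (i - r) =
          of_nat ((i choose r) * 2 ^ (i - r) * t ^ r) * y ^ (i + r)"
        by (simp add: power_mult_distrib mult_ac)
    qed
    finally show ?thesis
      by (simp only: additive_map_sum[OF a] additive_map_of_nat[OF a])
        (simp add: Q_def poly_sum poly_monom mult_ac)
  qed
  have cp: "component_poly j y = (\<Sum>i=1..j. smult (c i) (L y ^ (j - i) * Q i y))" for y
    using j by (intro component_polyI) (simp_all add: poly_sum Q L_def c mult_ac)
  have L: "coeff (L y ^ m) s = (if s \<le> m then of_nat (m choose s) * 2 ^ (m - s) else 0) * \<iota> y ^ (m + s)"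
    for y m s
  proof (cases "s \<le> m")
    case True
    then have "(\<iota> y ^ 2) ^ s * \<iota> y ^ (m - s) = \<iota> y ^ (m + s)"
      by (simp add: add.commute flip: power_mult power_add)
    then show ?thesis
      using True by (simp add: L_def coeff_linear_poly_power power_mult_distrib mult_ac)
  next
    case False
    have "degree (L y ^ m) \<le> degree (L y) * m" by (rule degree_power_le)
    also have "\<dots> < s" using False by (auto simp: L_def split: if_splits)
    finally show ?thesis using False by (simp add: coeff_eq_0)
  qed
  have "power_span a (j + l) (\<lambda>y. coeff (L y ^ (j - i)) s * coeff (Q i y) (l - s))"
    if "i \<in> {1..j}" "s \<le> l" for i s
  proof (cases "l - s \<le> i")
    case True
    let ?u = "(if s \<le> j - i then of_nat ((j - i) choose s) * 2 ^ (j - i - s) else 0) *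
        of_nat ((i choose (l - s)) * 2 ^ (i - (l - s))) :: 'b"
    have "(\<lambda>y. coeff (L y ^ (j - i)) s * coeff (Q i y) (l - s)) =
        (\<lambda>y. ?u * (\<iota> y ^ (j + l - (i + (l - s))) * a (y ^ (i + (l - s)))))"
      using True that by (simp add: L Q_def coeff_sum mult_ac)
    moreover have "power_span a (j + l) \<dots>"
      using that by (intro power_span_scale power_span_basis) auto
    ultimately show ?thesis by simp
  next
    case False
    then show ?thesis by (simp add: Q_def coeff_sum power_span_zero)
  qed
  then have "power_span a (j + l)
      (\<lambda>y. \<Sum>i=1..j. c i * (\<Sum>s\<le>l. coeff (L y ^ (j - i)) s * coeff (Q i y) (l - s)))"
    by (intro power_span_sum power_span_scale) auto
  then show ?thesis by (simp add: cp coeff_sum coeff_mult)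
qed

text \<open>The coefficient of \<open>t ^ k\<close> expresses \<open>(2 ^ k - 2) * F k\<close>
  through lower components, and the factor is nonzero for \<open>k\<close> at least 2. Degree 1 is
  the free datum \<open>a\<close>.\<close>

lemma power_span_component:
  assumes \<kappa>: "\<kappa> = 2" and a: "additive_map a" and F0: "F 0 = (\<lambda>_. 0)" and F1: "F 1 = a"
  shows "k \<le> n \<Longrightarrow> power_span a k (F k)"
proof (induction k rule: less_induct)
  case (less k)
  consider "k = 0" | "k = 1" | "k \<ge> 2" by linarith
  then show ?case
  proof cases
    case 1
    then show ?thesis by (simp add: F0 power_span_zero)
  next
    case 2
    then show ?thesis using power_span_basis[of 1 1 a] by (simp add: F1[simplified])
  next
    case 3
    let ?S = "\<lambda>y. \<Sum>j<k. of_nat (n choose (k - j)) * (\<iota> y ^ (k - j) * F j y)"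
    let ?T = "\<lambda>y. \<Sum>j<k. coeff (component_poly j y) (k - j)"
    have "?T y + 2 ^ k * F k y = 2 * (?S y + F k y)" for y
      using coeff_identity[where k = k and y = y] less.prems
      by (simp add: min_absorb1 lessThan_Suc_atMost[symmetric] coeff_component_poly_0 \<kappa> mult.assoc)
    then have *: "(2 ^ k - 2) * F k y = 2 * ?S y + (- 1) * ?T y" for y
      by (simp add: algebra_simps)
    have "power_span a k (\<lambda>y. 2 * ?S y + (- 1) * ?T y)"
    proof (intro power_span_add power_span_scale power_span_sum)
      fix j assume "j \<in> {..<k}"
      then show "power_span a k (\<lambda>y. \<iota> y ^ (k - j) * F j y)"
        using power_span_mult[OF less.IH[of j], of "k - j"] less.prems by simp
      show "power_span a k (\<lambda>y. coeff (component_poly j y) (k - j))"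
        using power_span_coeff_component_poly[OF a _ less.IH[of j], of "k - j"] less.prems
          \<open>j \<in> {..<k}\<close> by simp
    qed
    then have "power_span a k (\<lambda>y. (2 ^ k - 2) * F k y)" by (simp only: *)
    then have "power_span a k (\<lambda>y. inverse (2 ^ k - 2) * ((2 ^ k - 2) * F k y))"
      by (rule power_span_scale)
    moreover have "(2::'b) ^ k - 2 \<noteq> 0"
    proof -
      have "(2::nat) ^ k \<noteq> 2 ^ 1" using 3 by (subst power_inject_exp) auto
      then show ?thesis using of_nat_eq_iff[of "2 ^ k" "2", where 'a = 'b] by simp
    qed
    ultimately show ?thesis by (simp flip: mult.assoc)
  qed
qed

lemma eigenvalue_two:
  assumes \<kappa>: "\<kappa> = 2" and n: "n > 0"
  shows "\<exists>a c. higher_derivation \<iota> (2 * n - 1) a \<and>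
    (\<forall>x. A (replicate n x) = (\<Sum>j=1..n. c j * \<iota> x ^ (n - j) * a (x ^ j)))"
proof -
  define a where "a = F 1"
  have F0: "F 0 = (\<lambda>_. 0)"
    using lowest_component[of 0] by (simp add: \<kappa> fun_eq_iff)
  have add: "additive_map a"
  proof -
    have "symmetric_additive 1 (\<lambda>xs. A (replicate (n - 1) 1 @ xs))"
      using n by (intro symmetric_additive_append[OF sym_A]) simp
    from symmetric_additive_add[OF this, of "[]"] show ?thesis
      by (simp add: additive_map_def a_def F_def distrib_left)
  qed
  \<comment> \<open>\<open>F 0\<close> is constantly \<open>f 1\<close>, and \<open>a 1\<close> is
    \<open>n\<close> times \<open>f 1\<close>.\<close>
  have "A (replicate n 1) = 0"
    using F0 by (simp add: F_def fun_eq_iff)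
  moreover have "replicate (n - 1) 1 @ [1] = replicate n (1::'a)"
    using n by (cases n) (auto simp: replicate_append_same)
  ultimately have a1: "a 1 = 0" by (simp add: a_def F_def)
  obtain c where c: "\<And>x. A (replicate n x) = (\<Sum>j=1..n. c j * \<iota> x ^ (n - j) * a (x ^ j))"
    using power_span_component[OF \<kappa> add F0 a_def[symmetric], of n]
    unfolding power_span_def F_top by auto
  show ?thesis
  proof (cases "\<forall>j\<in>{1..n}. c j = 0")
    case True
    \<comment> \<open>No nontrivial relation for \<open>F 1\<close> is available here, but
      \<open>f\<close> vanishes, so the zero derivation serves as witness.\<close>
    then have "A (replicate n x) = 0" for x by (simp add: c)
    moreover have "higher_derivation \<iota> (2 * n - 1) (\<lambda>_. 0)"
      by (rule higher_derivation_mono[of 0]) simp_all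
    ultimately show ?thesis by (intro exI[of _ "\<lambda>_. 0"]) simp
  next
    case False
    define J where "J = Max {j \<in> {1..n}. c j \<noteq> 0}"
    have "J \<in> {j \<in> {1..n}. c j \<noteq> 0}"
      unfolding J_def using False by (intro Max_in) auto
    then have J: "1 \<le> J" "J \<le> n" "c J \<noteq> 0" by auto
    have top: "c j = 0" if "J < j" "j \<le> n" for j
    proof (rule ccontr)
      assume "c j \<noteq> 0"
      then have "j \<le> J" unfolding J_def using that J by (intro Max_ge) auto
      with that show False by simp
    qed
    \<comment> \<open>\<open>\<mu>1\<close> collects \<open>f (x ^ 2)\<close>, where
      \<open>c j\<close> moves to index \<open>2 * j\<close>, and \<open>\<mu>2\<close> collects
      \<open>2 * x ^ n * f x\<close>. Since \<open>2 * J > J\<close>, the second contributes nothing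
      at \<open>2 * J\<close> or above, so the top coefficient is \<open>c J\<close>.\<close>
    define \<mu>1 where "\<mu>1 i = (if even i then c (i div 2) else 0)" for i
    define \<mu>2 where "\<mu>2 i = (if i \<le> n then 2 * c i else 0)" for i
    define \<mu> where "\<mu> i = \<mu>1 i - \<mu>2 i" for i
    have "higher_derivation \<iota> (2 * n - 1) a"
    proof (rule higher_derivation_of_relation[OF add a1, where \<mu> = \<mu> and J = "2 * J"])
      fix x
      have "(\<Sum>i=1..2*n. \<mu>1 i * \<iota> x ^ (2 * n - i) * a (x ^ i)) =
          (\<Sum>i\<in>(*) 2 ` {1..n}. \<mu>1 i * \<iota> x ^ (2 * n - i) * a (x ^ i))"
      proof (rule sum.mono_neutral_right)
        show "\<forall>i\<in>{1..2*n} - (*) 2 ` {1..n}. \<mu>1 i * \<iota> x ^ (2 * n - i) * a (x ^ i) = 0"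
        proof
          fix i assume i: "i \<in> {1..2*n} - (*) 2 ` {1..n}"
          have "odd i"
          proof
            assume "even i"
            then obtain k where "i = 2 * k" by (rule evenE)
            with i show False by auto
          qed
          then show "\<mu>1 i * \<iota> x ^ (2 * n - i) * a (x ^ i) = 0" by (simp add: \<mu>1_def)
        qed
      qed auto
      also have "\<dots> = (\<Sum>j=1..n. c j * \<iota> (x ^ 2) ^ (n - j) * a ((x ^ 2) ^ j))"
        by (subst sum.reindex)
          (auto simp: inj_on_def \<mu>1_def diff_mult_distrib2 simp flip: power_mult intro!: sum.cong)
      also have "\<dots> = A (replicate n (x ^ 2))" by (simp only: c)
      finally have 1: "(\<Sum>i=1..2*n. \<mu>1 i * \<iota> x ^ (2 * n - i) * a (x ^ i)) = A (replicate n (x ^ 2))" .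
      have "(\<Sum>i=1..2*n. \<mu>2 i * \<iota> x ^ (2 * n - i) * a (x ^ i)) =
          (\<Sum>i=1..n. \<mu>2 i * \<iota> x ^ (2 * n - i) * a (x ^ i))"
        by (rule sum.mono_neutral_right) (auto simp: \<mu>2_def)
      also have "\<dots> = (\<Sum>i=1..n. 2 * \<iota> x ^ n * (c i * \<iota> x ^ (n - i) * a (x ^ i)))"
      proof (intro sum.cong refl)
        fix i assume "i \<in> {1..n}"
        then have "\<iota> x ^ (2 * n - i) = \<iota> x ^ n * \<iota> x ^ (n - i)" "i \<le> n"
          by (auto simp: mult_2 simp flip: power_add)
        then show "\<mu>2 i * \<iota> x ^ (2 * n - i) * a (x ^ i) =
            2 * \<iota> x ^ n * (c i * \<iota> x ^ (n - i) * a (x ^ i))"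
          by (simp add: \<mu>2_def)
      qed
      also have "\<dots> = 2 * \<iota> x ^ n * A (replicate n x)"
        by (simp only: c sum_distrib_left)
      finally show "(\<Sum>i=1..2*n. \<mu> i * \<iota> x ^ (2 * n - i) * a (x ^ i)) = 0"
        using 1 eq[of x] by (simp add: \<mu>_def left_diff_distrib sum_subtractf \<kappa>)
    next
      show "1 \<le> 2 * J" "2 * J \<le> 2 * n" using J by auto
      show "\<mu> (2 * J) \<noteq> 0" using J top[of "2 * J"] by (simp add: \<mu>_def \<mu>1_def \<mu>2_def)
    next
      fix j assume "2 * J < j" "j \<le> 2 * n"
      then show "\<mu> j = 0"
        using top[of j] top[of "j div 2"] by (auto simp: \<mu>_def \<mu>1_def \<mu>2_def elim!: evenE)
    qed
    with c show ?thesis by blast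
  qed
qed

end

section \<open>Polarization over all permutations\<close>

text \<open>\<open>B\<close> is first symmetrized to \<open>T\<close>; on the diagonal every summand
  of \<open>T\<close> is a diagonal value of \<open>B\<close>, hence zero, and polarization applies
  to \<open>T\<close>. The shift by one in \<open>T\<close> matches list positions with permutations
  of \<open>{1..m}\<close>.\<close>

lemma symmetrization_zero:
  fixes B :: "'a::ring_1 list \<Rightarrow> 'b::field_char_0"
  assumes B: "n_additive m B" and diag: "\<And>y. B (replicate m y) = 0"
  shows "(\<Sum>\<sigma> | \<sigma> permutes {1..m}. B (map (\<lambda>i. x (\<sigma> i)) [1..<Suc m])) = 0"
proof -
  define T where "T xs = (\<Sum>\<sigma> | \<sigma> permutes {1..m}. B (map (\<lambda>i. xs ! (\<sigma> i - 1)) [1..<Suc m]))" for xs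
  have range: "\<sigma> i \<in> {1..m}" if "\<sigma> permutes {1..m}" "i \<in> {1..m}" for \<sigma> i
    using that by (simp only: permutes_in_image)
  have T_eq: "T xs = (\<Sum>\<sigma> | \<sigma> permutes {1..m}. B (map (\<lambda>i. h (\<sigma> i)) [1..<Suc m]))"
    if h: "\<And>i. i \<in> {1..m} \<Longrightarrow> xs ! (i - 1) = h i" for xs h
    unfolding T_def
  proof (rule sum.cong[OF refl])
    fix \<sigma> assume "\<sigma> \<in> {\<sigma>. \<sigma> permutes {1..m}}"
    then have "\<sigma> i \<in> {1..m}" if "i \<in> {1..m}" for i using range that by blast
    then have "map (\<lambda>i. xs ! (\<sigma> i - 1)) [1..<Suc m] = map (\<lambda>i. h (\<sigma> i)) [1..<Suc m]"
      by (intro map_cong[OF refl] h) (simp del: upt_Suc)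
    then show "B (map (\<lambda>i. xs ! (\<sigma> i - 1)) [1..<Suc m]) = B (map (\<lambda>i. h (\<sigma> i)) [1..<Suc m])"
      by (rule arg_cong)
  qed
  have "n_additive m T"
    unfolding n_additive_def
  proof (intro allI impI)
    fix xs :: "'a list" and j u v assume *: "length xs = m \<and> j < m"
    have "B (map (\<lambda>i. xs[j := u + v] ! (\<sigma> i - 1)) [1..<Suc m]) =
        B (map (\<lambda>i. xs[j := u] ! (\<sigma> i - 1)) [1..<Suc m]) +
        B (map (\<lambda>i. xs[j := v] ! (\<sigma> i - 1)) [1..<Suc m])" if \<sigma>: "\<sigma> permutes {1..m}" for \<sigma>
    proof -
      \<comment> \<open>Replacing entry \<open>j\<close> of \<open>xs\<close> changes exactly one
        argument of \<open>B\<close>: the position \<open>l\<close> with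
        \<open>\<sigma> (Suc l) = Suc j\<close>.\<close>
      define l where "l = inv \<sigma> (Suc j) - 1"
      have "inv \<sigma> (Suc j) \<in> {1..m}"
        using range[OF permutes_inv[OF \<sigma>], of "Suc j"] * by simp
      then have l: "l < m" "inv \<sigma> (Suc j) = Suc l" by (auto simp: l_def)
      have "map (\<lambda>i. xs[j := w] ! (\<sigma> i - 1)) [1..<Suc m] =
          (map (\<lambda>i. xs ! (\<sigma> i - 1)) [1..<Suc m])[l := w]" for w
      proof (rule nth_equalityI)
        fix k assume "k < length (map (\<lambda>i. xs[j := w] ! (\<sigma> i - 1)) [1..<Suc m])"
        then have k: "k < m" by (simp del: upt_Suc)
        have \<sigma>k: "\<sigma> (Suc k) \<in> {1..m}" using range[OF \<sigma>, of "Suc k"] k by simp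
        have "\<sigma> (Suc k) - 1 = j \<longleftrightarrow> \<sigma> (Suc k) = Suc j" using \<sigma>k by auto
        also have "\<dots> \<longleftrightarrow> k = l"
          using l(2) permutes_inverses[OF \<sigma>] by (metis Suc_inject)
        finally show "map (\<lambda>i. xs[j := w] ! (\<sigma> i - 1)) [1..<Suc m] ! k =
            (map (\<lambda>i. xs ! (\<sigma> i - 1)) [1..<Suc m])[l := w] ! k"
          using k * \<sigma>k by (auto simp del: upt_Suc simp: nth_list_update)
      qed simp
      then show ?thesis
        using B l(1) unfolding n_additive_def by simp
    qed
    then show "T (xs[j := u + v]) = T (xs[j := u]) + T (xs[j := v])"
      unfolding T_def sum.distrib[symmetric] by (intro sum.cong) auto
  qed
  moreover have "symmetric_map m T"
    unfolding symmetric_map_def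
  proof (intro allI impI)
    fix xs :: "'a list" and \<tau> assume *: "length xs = m \<and> \<tau> permutes {..<m}"
    then have \<tau>p: "\<tau> permutes {..<m}" by blast
    have \<tau>: "\<tau> k < m" "inv \<tau> k < m" "\<tau> (inv \<tau> k) = k" "inv \<tau> (\<tau> k) = k" if "k < m" for k
      using that permutes_in_image[OF \<tau>p, of k] permutes_in_image[OF permutes_inv[OF \<tau>p], of k]
      by (simp_all add: permutes_inverses[OF \<tau>p])
    \<comment> \<open>\<open>q\<close> is \<open>\<tau>\<close> transported to
      \<open>{1..m}\<close>. Permuting the entries of \<open>xs\<close> then composes each
      \<open>\<sigma>\<close> with \<open>q\<close> on the left, which only reindexes the
      sum.\<close>
    define q where "q k = (if k \<in> {1..m} then Suc (\<tau> (k - 1)) else k)" for k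
    have "bij_betw q {1..m} {1..m}"
      by (rule bij_betw_byWitness[where f' = "\<lambda>k. Suc (inv \<tau> (k - 1))"])
        (auto simp: q_def \<tau> Suc_leI)
    then have q: "q permutes {1..m}"
      by (rule bij_imp_permutes) (auto simp: q_def)
    have "T (map (\<lambda>i. xs ! \<tau> i) [0..<m]) =
        (\<Sum>\<sigma> | \<sigma> permutes {1..m}. B (map (\<lambda>i. xs ! ((q \<circ> \<sigma>) i - 1)) [1..<Suc m]))"
      unfolding o_def by (rule T_eq) (auto simp: q_def)
    also have "\<dots> = T xs"
      unfolding T_def by (rule setum_permutations_compose_left[OF q, symmetric])
    finally show "T (map (\<lambda>i. xs ! \<tau> i) [0..<m]) = T xs" .
  qed
  ultimately have sym: "symmetric_additive m T" by (rule symmetric_additive_of_n_additive)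
  have "T (replicate m y) = 0" for y
  proof -
    have "T (replicate m y) = (\<Sum>\<sigma> | \<sigma> permutes {1..m}. B (map (\<lambda>i. y) [1..<Suc m]))"
      by (rule T_eq) auto
    then show ?thesis by (simp add: map_replicate_const diag del: upt_Suc)
  qed
  from polarization_zero[OF sym this, of "map x [1..<Suc m]"]
  have "T (map x [1..<Suc m]) = 0" by simp
  moreover have "T (map x [1..<Suc m]) =
      (\<Sum>\<sigma> | \<sigma> permutes {1..m}. B (map (\<lambda>i. x (\<sigma> i)) [1..<Suc m]))"
    by (rule T_eq) (auto simp del: upt_Suc)
  ultimately show ?thesis by simp
qed

text \<open>This packages the summand of (iv) as a map of one list, ready for symmetrization.
  Positions 0 and 1 enter bilinearly through products and heads; every later position lies in the
  tail shared by all three terms.\<close>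

lemma n_additive_leibniz_defect:
  fixes \<iota> :: "'a::ring_1 \<Rightarrow> 'b::comm_ring_1"
  assumes A: "n_additive (Suc m) A" and \<iota>: "\<And>x y. \<iota> (x + y) = \<iota> x + \<iota> y"
  shows "n_additive (Suc (Suc m)) (\<lambda>ys. A ((ys ! 0 * ys ! 1) # drop 2 ys)
    - \<iota> (ys ! 0) * A (tl ys) - \<iota> (ys ! 1) * A (ys ! 0 # drop 2 ys))"
  unfolding n_additive_def
proof (intro allI impI)
  fix ys :: "'a list" and i x y
  assume *: "length ys = Suc (Suc m) \<and> i < Suc (Suc m)"
  then obtain u v zs where ys: "ys = u # v # zs" "length zs = m"
    by (auto simp: length_Suc_conv)
  have head: "A ((x + y) # zs) = A (x # zs) + A (y # zs)" for x y
    using A[unfolded n_additive_def, rule_format, of "x # zs" 0 x y] ys by simp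
  have tail: "A (w # zs[k := x + y]) = A (w # zs[k := x]) + A (w # zs[k := y])" if "k < m" for w k
    using A[unfolded n_additive_def, rule_format, of "w # zs" "Suc k" x y] ys that by simp
  consider "i = 0" | "i = 1" | k where "i = Suc (Suc k)" "k < m"
    using * by (metis One_nat_def Suc_less_eq not0_implies_Suc)
  then show "A ((ys[i := x + y] ! 0 * ys[i := x + y] ! 1) # drop 2 (ys[i := x + y]))
      - \<iota> (ys[i := x + y] ! 0) * A (tl (ys[i := x + y]))
      - \<iota> (ys[i := x + y] ! 1) * A (ys[i := x + y] ! 0 # drop 2 (ys[i := x + y])) =
      A ((ys[i := x] ! 0 * ys[i := x] ! 1) # drop 2 (ys[i := x]))
      - \<iota> (ys[i := x] ! 0) * A (tl (ys[i := x]))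
      - \<iota> (ys[i := x] ! 1) * A (ys[i := x] ! 0 # drop 2 (ys[i := x])) +
      (A ((ys[i := y] ! 0 * ys[i := y] ! 1) # drop 2 (ys[i := y]))
      - \<iota> (ys[i := y] ! 0) * A (tl (ys[i := y]))
      - \<iota> (ys[i := y] ! 1) * A (ys[i := y] ! 0 # drop 2 (ys[i := y])))"
    by cases (auto simp: ys \<iota> head tail algebra_simps)
qed

section \<open>Assembly of the four claims\<close>

theorem mainTheorem1:
  fixes \<iota> :: "'a::field_char_0 \<Rightarrow> 'b::field_char_0"
    and f :: "'a \<Rightarrow> 'b" and n :: nat and \<kappa> :: 'b
  assumes emb: "field_embedding \<iota>"
    and n_pos: "0 < n"
    and mono: "generalized_monomial n f"
    and eq: "\<forall>x. f (x ^ 2) = \<kappa> * \<iota> x ^ n * f x"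
  shows "(\<kappa> \<notin> {2 ^ k | k. k \<le> n} \<longrightarrow> (\<forall>x. f x = 0))
    \<and> (\<kappa> = 1 \<longrightarrow> (\<forall>x. f x = f 1 * \<iota> x ^ n))
    \<and> (\<kappa> = 2 \<longrightarrow> (\<exists>a c. higher_derivation \<iota> (2 * n - 1) a \<and>
          (\<forall>x. f x = (\<Sum>j = 1..n. c j * \<iota> x ^ (n - j) * a (x ^ j)))))
    \<and> (\<kappa> = 2 ^ n \<longrightarrow> (\<exists>A. n_additive n A \<and> symmetric_map n A \<and>
          (\<forall>x. f x = A (replicate n x)) \<and>
          (\<forall>x :: nat \<Rightarrow> 'a.
             (\<Sum>\<sigma> \<in> {\<sigma>. \<sigma> permutes {1..n+1}}.
                A ((x (\<sigma> 1) * x (\<sigma> 2)) # map (\<lambda>i. x (\<sigma> i)) [3..<n+2])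
                - \<iota> (x (\<sigma> 1)) * A (map (\<lambda>i. x (\<sigma> i)) [2..<n+2])
                - \<iota> (x (\<sigma> 2)) * A (x (\<sigma> 1) # map (\<lambda>i. x (\<sigma> i)) [3..<n+2])) = 0)))"
proof -
  obtain A where A: "n_additive n A" "symmetric_map n A" and f: "\<And>x. f x = A (replicate n x)"
    using mono unfolding generalized_monomial_def by blast
  interpret square_equation \<iota> n \<kappa> A
    using emb eq symmetric_additive_of_n_additive[OF A] by unfold_locales (auto simp: f)
  have i: "f x = 0" if "\<kappa> \<notin> {2 ^ k | k. k \<le> n}" for x
    unfolding f F_top[symmetric] using that by (intro components_zero[of "Suc n"]) auto
  have iv: "\<exists>A. n_additive n A \<and> symmetric_map n A \<and>
          (\<forall>x. f x = A (replicate n x)) \<and>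
          (\<forall>x :: nat \<Rightarrow> 'a.
             (\<Sum>\<sigma> \<in> {\<sigma>. \<sigma> permutes {1..n+1}}.
                A ((x (\<sigma> 1) * x (\<sigma> 2)) # map (\<lambda>i. x (\<sigma> i)) [3..<n+2])
                - \<iota> (x (\<sigma> 1)) * A (map (\<lambda>i. x (\<sigma> i)) [2..<n+2])
                - \<iota> (x (\<sigma> 2)) * A (x (\<sigma> 1) # map (\<lambda>i. x (\<sigma> i)) [3..<n+2])) = 0)"
    if \<kappa>: "\<kappa> = 2 ^ n"
  proof (intro exI[of _ A] conjI allI A f)
    fix x :: "nat \<Rightarrow> 'a"
    obtain m where m: "n = Suc m" using n_pos by (cases n) auto
    define B where "B ys = A ((ys ! 0 * ys ! 1) # drop 2 ys)
      - \<iota> (ys ! 0) * A (tl ys) - \<iota> (ys ! 1) * A (ys ! 0 # drop 2 ys)" for ys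
    have "n_additive (Suc n) B"
      using n_additive_leibniz_defect[of m A \<iota>] A(1) unfolding m B_def by simp
    \<comment> \<open>On the diagonal the two subtracted terms coincide, which is the factor 2 in
      \<open>eigenvalue_top\<close>.\<close>
    moreover have "B (replicate (Suc n) y) = 0" for y
      using eigenvalue_top[OF \<kappa> m, of y] by (simp add: B_def m power2_eq_square)
    ultimately have "(\<Sum>\<sigma> | \<sigma> permutes {1..Suc n}. B (map (\<lambda>i. x (\<sigma> i)) [1..<Suc (Suc n)])) = 0"
      by (rule symmetrization_zero)
    moreover have "[1..<Suc (Suc n)] = 1 # 2 # [3..<n+2]" "[2..<n+2] = 2 # [3..<n+2]"
      by (simp_all add: m upt_conv_Cons numeral_2_eq_2 numeral_3_eq_3 del: upt_Suc)
    ultimately show "(\<Sum>\<sigma> \<in> {\<sigma>. \<sigma> permutes {1..n+1}}.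
        A ((x (\<sigma> 1) * x (\<sigma> 2)) # map (\<lambda>i. x (\<sigma> i)) [3..<n+2])
        - \<iota> (x (\<sigma> 1)) * A (map (\<lambda>i. x (\<sigma> i)) [2..<n+2])
        - \<iota> (x (\<sigma> 2)) * A (x (\<sigma> 1) # map (\<lambda>i. x (\<sigma> i)) [3..<n+2])) = 0"
      by (simp add: B_def del: upt_Suc)
  qed
  show ?thesis
    unfolding f by (intro conjI impI allI i[unfolded f] iv[unfolded f] eigenvalue_one eigenvalue_two n_pos)
qed

end
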